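(* Let $\mathbb{D}^*=\{z\in\mathbb{C}: 0<|z|<1\}$. For any $z\in\mathbb{D}^*$, $$H^c_{\mathbb{D}^*}(z)=|z|.$$
   Context: $\mathbb{D}$ is the open unit disk in $\mathbb{C}$, and $\rho_{\mathbb{D}}$ is the Poincaré distance on $\mathbb{D}$ with density $\frac{2}{1-|z|^2}$. For a Riemann surface $X$, the Carathéodory pseudo-distance is $c_X(z_1,z_2)=\sup\{\rho_{\mathbb{D}}(f(z_1),f(z_2)) : f:X\to\mathbb{D}\text{ holomorphic}\}$. Put $B^c_X(z;r)=\{w\in X: c_X(z,w)<r\}$. The Fridman function of $X$ with respect to the Carathéodory metric is $$H^c_X(z)=\sup\{\tanh\tfrac r2 : r>0,\ B^c_X(z;r)\subset f(\mathbb{D})\text{ for some injective holomorphic } f:\mathbb{D}\to X\}.$$ *)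

theory Defs
  imports "HOL-Complex_Analysis.Complex_Analysis"
begin

abbreviation unit_disk :: "complex set"
  where "unit_disk \<equiv> ball 0 1"

definition punctured_unit_disk :: "complex set"
  where "punctured_unit_disk = {z. 0 < norm z \<and> norm z < 1}"

text \<open>
  The derivative of a valid path may be unbounded near the finitely many exceptional parameters, so
  its length may be infinite.  The length is therefore a relation: a path of infinite length has
  no length here, whereas \<^const>\<open>integral\<close> would silently assign it the value 0.
\<close>

definition has_poincare_length :: "(real \<Rightarrow> complex) \<Rightarrow> real \<Rightarrow> bool"
  where "has_poincare_length \<gamma> L \<longleftrightarrow>
    ((\<lambda>t. 2 / (1 - (norm (\<gamma> t))\<^sup>2) * norm (vector_derivative \<gamma> (at t within {0..1})))
      has_integral L) {0..1}"

definition poincare_dist :: "complex \<Rightarrow> complex \<Rightarrow> real"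
  where "poincare_dist z w =
    Inf {L. \<exists>\<gamma>. valid_path \<gamma> \<and> path_image \<gamma> \<subseteq> unit_disk \<and>
                pathstart \<gamma> = z \<and> pathfinish \<gamma> = w \<and> has_poincare_length \<gamma> L}"

text \<open>
  The Riemann surface \<open>X\<close> is an open subset of the complex plane.  The supremum is taken in the
  extended reals because it is infinite for points in different components of \<open>X\<close>.
\<close>

definition caratheodory_dist :: "complex set \<Rightarrow> complex \<Rightarrow> complex \<Rightarrow> ereal"
  where "caratheodory_dist X z\<^sub>1 z\<^sub>2 =
    Sup {ereal (poincare_dist (f z\<^sub>1) (f z\<^sub>2)) |f. f holomorphic_on X \<and> f ` X \<subseteq> unit_disk}"

definition caratheodory_ball :: "complex set \<Rightarrow> complex \<Rightarrow> real \<Rightarrow> complex set"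
  where "caratheodory_ball X z r = {w \<in> X. caratheodory_dist X z w < ereal r}"

text \<open>
  The set of values is bounded above by 1.  If no \<open>r\<close> is admissible, as for the whole plane, the
  supremum of the empty set of reals carries no meaning; every \<open>X\<close> with small Caratheodory balls
  contained in Euclidean disks inside \<open>X\<close> avoids this case.
\<close>

definition fridman_caratheodory :: "complex set \<Rightarrow> complex \<Rightarrow> real"
  where "fridman_caratheodory X z =
    Sup {tanh (r / 2) |r. r > 0 \<and>
           (\<exists>f. f holomorphic_on unit_disk \<and> inj_on f unit_disk \<and> f ` unit_disk \<subseteq> X \<and>
                caratheodory_ball X z r \<subseteq> f ` unit_disk)}"

end

theory Submission
  imports Defs
begin

text \<open>
  By the removable singularity theorem, holomorphic maps from the punctured disk to the disk extend
  over the origin, so by Schwarz-Pick its Caratheodory distance is the restriction of the Poincare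
  distance of the disk, namely \<open>2 artanh |M\<^sub>z(w)|\<close> with \<open>M\<^sub>z(w) = (w - z) / (1 - cnj z w)\<close>.
  A Caratheodory ball about \<open>z\<close> is thus the pseudohyperbolic disk \<open>|M\<^sub>z| < tanh (r/2)\<close> without the
  origin, and \<open>|M\<^sub>z(0)| = |z|\<close>.  For \<open>tanh (r/2) = |z|\<close> this is itself a conformal disk.  For
  \<open>tanh (r/2) > |z|\<close> it contains a circle about the origin, which does not fit into a simply
  connected subset of the punctured disk.
\<close>

section \<open>Real artanh and tanh\<close>

lemma artanh_real_less_iff:
  fixes x y :: real
  assumes "\<bar>x\<bar> < 1" "\<bar>y\<bar> < 1"
  shows "artanh x < artanh y \<longleftrightarrow> x < y"
proof -
  have "artanh x < artanh y \<longleftrightarrow> (1 + x) / (1 - x) < (1 + y) / (1 - y)"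
    using assms by (simp add: artanh_def abs_less_iff)
  also have "\<dots> \<longleftrightarrow> x < y"
    using assms by (simp add: abs_less_iff field_simps)
  finally show ?thesis .
qed

lemma tanh_artanh_real:
  fixes x :: real
  assumes "\<bar>x\<bar> < 1"
  shows "tanh (artanh x) = x"
proof -
  have "exp (- (2 * artanh x)) = (1 - x) / (1 + x)"
    using assms by (simp add: artanh_def abs_less_iff exp_minus)
  then have "tanh (artanh x) = (1 - (1 - x) / (1 + x)) / (1 + (1 - x) / (1 + x))"
    by (simp add: tanh_real_altdef)
  also have "\<dots> = x"
    using assms by (simp add: abs_less_iff divide_simps)
  finally show ?thesis .
qed

section \<open>Moebius maps as isometries of the Poincare density\<close>

lemma Moebius_denominator_nonzero:
  fixes a z :: complex
  assumes "norm a < 1" "norm z < 1"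
  shows "1 - cnj a * z \<noteq> 0"
proof
  assume "1 - cnj a * z = 0"
  then have "norm (cnj a * z) = 1" by simp
  moreover have "norm (cnj a) * norm z < 1 * 1"
    using assms by (intro mult_strict_mono') auto
  ultimately show False by (simp add: norm_mult)
qed

text \<open>After clearing the denominator, the terms \<open>2 * Re (cnj a * z)\<close> of the two
  expanded squares cancel.\<close>

lemma one_minus_norm_Moebius_sq:
  assumes "norm a < 1" "norm z < 1"
  shows "1 - (norm (Moebius_function 0 a z))\<^sup>2 =
    (1 - (norm a)\<^sup>2) * (1 - (norm z)\<^sup>2) / (norm (1 - cnj a * z))\<^sup>2"
proof -
  have *: "(norm (1 - cnj a * z))\<^sup>2 - (norm (z - a))\<^sup>2 = (1 - (norm a)\<^sup>2) * (1 - (norm z)\<^sup>2)"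
    unfolding cmod_power2 by (simp add: power2_eq_square algebra_simps)
  show ?thesis
    using Moebius_denominator_nonzero[OF assms] unfolding Moebius_function_simple
    by (simp add: norm_divide power_divide diff_divide_eq_iff divide_simps flip: *)
qed

lemma Moebius_has_field_derivative:
  assumes "norm a < 1" "norm z < 1"
  shows "(Moebius_function 0 a has_field_derivative
    of_real (1 - (norm a)\<^sup>2) / (1 - cnj a * z)\<^sup>2) (at z)"
proof -
  \<comment> \<open>This is the numerator that the quotient rule produces:
    \<open>(1 - cnj a * z) + cnj a * (z - a)\<close>.\<close>
  have "complex_of_real (1 - (norm a)\<^sup>2) = 1 - a * cnj a"
    using complex_norm_square[of a] by simp
  then show ?thesis
    unfolding Moebius_function_simple[abs_def]
    using Moebius_denominator_nonzero[OF assms]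
    by (auto intro!: derivative_eq_intros simp: power2_eq_square algebra_simps)
qed

text \<open>The first norm is that of the derivative of the Moebius map, so pulling the Poincare
  density back along the map reproduces it.\<close>

lemma Moebius_infinitesimal_isometry:
  assumes "norm a < 1" "norm z < 1"
  shows "norm (of_real (1 - (norm a)\<^sup>2) / (1 - cnj a * z)\<^sup>2) / (1 - (norm (Moebius_function 0 a z))\<^sup>2)
    = 1 / (1 - (norm z)\<^sup>2)"
proof -
  have "0 < 1 - (norm a)\<^sup>2" using assms by (simp add: power_less_one_iff)
  moreover have "norm (complex_of_real (1 - (norm a)\<^sup>2)) = 1 - (norm a)\<^sup>2"
    using calculation by (simp only: norm_of_real)
  ultimately show ?thesis
    unfolding one_minus_norm_Moebius_sq[OF assms] norm_divide norm_power
    using Moebius_denominator_nonzero[OF assms] by simp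
qed

lemma Moebius_inverse:
  assumes "norm a < 1" "norm z < 1"
  shows "Moebius_function 0 (- a) (Moebius_function 0 a z) = z"
    and "Moebius_function 0 a (Moebius_function 0 (- a) z) = z"
  using assms by (auto intro: Moebius_function_compose)

section \<open>The Poincare distance in closed form\<close>

lemma poincare_length_ge:
  assumes "valid_path \<gamma>" "path_image \<gamma> \<subseteq> unit_disk" "pathstart \<gamma> = a" "pathfinish \<gamma> = b"
    and L: "has_poincare_length \<gamma> L"
  shows "2 * artanh (norm (Moebius_function 0 a b)) \<le> L"
proof -
  have ab: "norm a < 1" "norm b < 1"
    using assms(2-4) pathstart_in_path_image[of \<gamma>] pathfinish_in_path_image[of \<gamma>] by auto
  define p where "p = Moebius_function 0 a b"
  have p1: "norm p < 1"
    unfolding p_def using ab by (rule Moebius_function_norm_lt_1)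
  \<comment> \<open>The rotation \<open>u\<close> turns \<open>p\<close> onto the nonnegative real
    axis, so that \<open>m b\<close> below is the real number \<open>norm p\<close>.\<close>
  obtain u where u: "norm u = 1" "u * p = of_real (norm p)"
  proof (cases "p = 0")
    case False
    then show ?thesis
      by (intro that[of "of_real (norm p) / p"]) (auto simp: norm_divide)
  qed (auto intro: that[of 1])
  define m where "m = (\<lambda>w. u * Moebius_function 0 a w)"
  define d where "d = (\<lambda>w. u * (of_real (1 - (norm a)\<^sup>2) / (1 - cnj a * w)\<^sup>2))"
  \<comment> \<open>Since \<open>F = G \<circ> m\<close> with \<open>G' = 2 / (1 - z\<^sup>2)\<close>, \<open>|F'|\<close> is at most the Poincare density, with equality
    where \<open>m\<close> is real, that is, on the geodesic from \<open>a\<close> to \<open>b\<close>.\<close>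
  define F where "F = (\<lambda>w. Ln (1 + m w) - Ln (1 - m w))"
  define F' where "F' = (\<lambda>w. 2 * d w / (1 - (m w)\<^sup>2))"
  have m1: "norm (m w) < 1" if "norm w < 1" for w
    using Moebius_function_norm_lt_1[OF ab(1) that] by (simp add: m_def norm_mult u)
  have F_deriv: "(F has_field_derivative F' w) (at w within unit_disk)" if "w \<in> unit_disk" for w
  proof -
    have w: "norm w < 1" using that by simp
    have d: "(m has_field_derivative d w) (at w)"
      unfolding m_def d_def by (intro DERIV_cmult Moebius_has_field_derivative ab w)
    \<comment> \<open>A real part in (-1, 1) keeps both \<open>1 + m w\<close> and
      \<open>1 - m w\<close> in the right half-plane, off the branch cut of
      \<open>Ln\<close>.\<close>
    have Re: "\<bar>Re (m w)\<bar> < 1"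
      using abs_Re_le_cmod[of "m w"] m1[OF w] by linarith
    then have "1 + m w \<notin> \<real>\<^sub>\<le>\<^sub>0" "1 - m w \<notin> \<real>\<^sub>\<le>\<^sub>0" "1 + m w \<noteq> 0" "1 - m w \<noteq> 0"
      by (auto simp: complex_nonpos_Reals_iff complex_eq_iff)
    then have "(F has_field_derivative F' w) (at w)"
      unfolding F_def F'_def
      by (auto intro!: derivative_eq_intros d simp: divide_simps power2_eq_square algebra_simps)
    then show ?thesis by (rule has_field_derivative_at_within)
  qed
  have F'_le: "norm (F' w) \<le> 2 / (1 - (norm w)\<^sup>2)" if w: "norm w < 1" for w
  proof -
    have pos: "0 < 1 - (norm (m w))\<^sup>2" using m1[OF w] by (simp add: power_less_one_iff)
    have "1 - (norm (m w))\<^sup>2 \<le> norm (1 - (m w)\<^sup>2)"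
      using norm_triangle_ineq2[of 1 "(m w)\<^sup>2"] by (simp add: norm_power)
    then have "norm (F' w) \<le> 2 * norm (d w) / (1 - (norm (m w))\<^sup>2)"
      using pos unfolding F'_def norm_divide norm_mult
      by (intro frac_le) auto
    also have "\<dots> = 2 * (1 / (1 - (norm w)\<^sup>2))"
      unfolding Moebius_infinitesimal_isometry[OF ab(1) w, symmetric]
      unfolding m_def d_def norm_mult u by simp
    finally show ?thesis by simp
  qed
  have "(F' has_contour_integral (F (pathfinish \<gamma>) - F (pathstart \<gamma>))) \<gamma>"
    using F_deriv assms(1,2) by (rule contour_integral_primitive)
  then have I: "((\<lambda>t. F' (\<gamma> t) * vector_derivative \<gamma> (at t within {0..1})) has_integral (F b - F a)) {0..1}"
    by (simp add: has_contour_integral_def assms)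
  \<comment> \<open>The integral of \<open>F'\<close> depends only on the end points, and
    \<open>L\<close> is the integral of a majorant of its integrand.\<close>
  have "norm (F b - F a) \<le> L"
  proof -
    have "norm (F' (\<gamma> t) * vector_derivative \<gamma> (at t within {0..1}))
      \<le> 2 / (1 - (norm (\<gamma> t))\<^sup>2) * norm (vector_derivative \<gamma> (at t within {0..1}))"
      if "t \<in> {0..1}" for t
      unfolding norm_mult using assms(2) that
      by (intro mult_right_mono F'_le) (auto simp: path_image_def image_subset_iff)
    from integral_norm_bound_integral[OF has_integral_integrable[OF I]
        has_integral_integrable[OF L[unfolded has_poincare_length_def]] this]
    show ?thesis
      using I L by (simp add: has_poincare_length_def integral_unique)
  qed
  \<comment> \<open>Here \<open>m a = 0\<close> and \<open>m b = norm p\<close>, so only the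
    logarithm of \<open>(1 + norm p) / (1 - norm p)\<close> remains.\<close>
  moreover have "F b - F a = of_real (2 * artanh (norm p))"
  proof -
    have "F b = Ln (of_real (1 + norm p)) - Ln (of_real (1 - norm p))"
      by (simp add: F_def m_def p_def[symmetric] u)
    also have "\<dots> = of_real (ln (1 + norm p) - ln (1 - norm p))"
      using p1 by (subst (1 2) Ln_of_real) (auto simp: add_pos_nonneg)
    also have "ln (1 + norm p) - ln (1 - norm p) = 2 * artanh (norm p)"
    proof -
      have "0 < 1 + norm p" using norm_ge_zero[of p] by linarith
      then show ?thesis using p1 by (simp add: artanh_def ln_divide_pos)
    qed
    finally have "F b = of_real (2 * artanh (norm p))" .
    moreover have "F a = 0"
      by (simp add: F_def m_def Moebius_function_eq_zero)
    ultimately show ?thesis by simp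
  qed
  ultimately show ?thesis
    by (simp add: p_def)
qed

text \<open>The path is the isometric image of the radius from 0 to \<open>p\<close>, hence a
  geodesic starting at \<open>a\<close>; its length is that of the radius. It shows that the lower
  bound on lengths is attained.\<close>

lemma Moebius_segment_length:
  assumes "norm a < 1" "norm p < 1"
  defines "\<gamma> \<equiv> Moebius_function 0 (- a) \<circ> linepath 0 p"
  shows "valid_path \<gamma>" "path_image \<gamma> \<subseteq> unit_disk"
    and "has_poincare_length \<gamma> (2 * artanh (norm p))"
proof -
  have a: "norm (- a) < 1" using assms by simp
  have seg: "closed_segment 0 p \<subseteq> unit_disk"
    using assms by (intro closed_segment_subset) auto
  note hol = Moebius_function_holomorphic[OF a, of 0]
  show "valid_path \<gamma>"
    unfolding \<gamma>_def
    using seg by (intro valid_path_compose_holomorphic[OF _ hol]) auto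
  show "path_image \<gamma> \<subseteq> unit_disk"
    unfolding \<gamma>_def path_image_compose
    using seg Moebius_function_norm_lt_1[OF a] by (auto simp: subset_iff)
  define q where "q = norm p"
  have q: "0 \<le> q" "q < 1" using assms by (auto simp: q_def)
  have tq: "0 \<le> t * q \<and> t * q < 1" if "t \<in> {0..1}" for t
    using that q mult_left_le_one_le[of q t] by auto
  \<comment> \<open>The integrand is the Poincare speed of the radius at parameter \<open>t\<close>;
    its antiderivative is \<open>2 * artanh (t * q)\<close>, written as a difference of
    logarithms.\<close>
  have "((\<lambda>t. 2 * q / (1 - (t * q)\<^sup>2)) has_integral
      ((ln (1 + 1 * q) - ln (1 - 1 * q)) - (ln (1 + 0 * q) - ln (1 - 0 * q)))) {0..1}"
  proof (rule fundamental_theorem_of_calculus)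
    fix t :: real assume t: "t \<in> {0..1}"
    have "((\<lambda>t. ln (1 + t * q) - ln (1 - t * q)) has_real_derivative 2 * q / (1 - (t * q)\<^sup>2)) (at t within {0..1})"
    proof -
      have "1 - (t * q)\<^sup>2 = (1 + t * q) * (1 - t * q)"
        by (simp add: power2_eq_square algebra_simps)
      then have "q / (1 + t * q) + q / (1 - t * q) = 2 * q / (1 - (t * q)\<^sup>2)"
        using tq[OF t] by (simp add: add_frac_eq algebra_simps)
      moreover have "((\<lambda>t. ln (1 + t * q) - ln (1 - t * q)) has_real_derivative
          q / (1 + t * q) + q / (1 - t * q)) (at t within {0..1})"
        using tq[OF t] by (auto intro!: derivative_eq_intros)
      ultimately show ?thesis by simp
    qed
    then show "((\<lambda>t. ln (1 + t * q) - ln (1 - t * q)) has_vector_derivative 2 * q / (1 - (t * q)\<^sup>2)) (at t within {0..1})"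
      by (simp add: has_real_derivative_iff_has_vector_derivative)
  qed simp
  also have "(ln (1 + 1 * q) - ln (1 - 1 * q)) - (ln (1 + 0 * q) - ln (1 - 0 * q)) = 2 * artanh q"
    using q by (simp add: artanh_def ln_div)
  finally have *: "((\<lambda>t. 2 * q / (1 - (t * q)\<^sup>2)) has_integral 2 * artanh q) {0..1}" .
  \<comment> \<open>The infinitesimal isometry reduces the speed of \<open>\<gamma>\<close> to that
    of the radius at the point \<open>w = t * p\<close>.\<close>
  have "2 / (1 - (norm (\<gamma> t))\<^sup>2) * norm (vector_derivative \<gamma> (at t within {0..1})) = 2 * q / (1 - (t * q)\<^sup>2)"
    if t: "t \<in> {0..1}" for t
  proof -
    define w where "w = linepath 0 p t"
    have w: "w = of_real t * p" by (simp add: w_def linepath_def scaleR_conv_of_real)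
    have nw: "norm w = t * q" using t by (simp add: w norm_mult q_def)
    then have w1: "norm w < 1" using tq[OF t] by simp
    define D where "D = of_real (1 - (norm (- a))\<^sup>2) / (1 - cnj (- a) * w)\<^sup>2"
    have "(\<gamma> has_vector_derivative p * D) (at t within {0..1})"
      unfolding \<gamma>_def D_def
      using Moebius_has_field_derivative[OF a w1]
      by (intro field_vector_diff_chain_within[of "linepath 0 p" p])
        (auto simp: w_def intro!: has_field_derivative_at_within
            has_vector_derivative_linepath_within[of 0 p, simplified])
    then have "vector_derivative \<gamma> (at t within {0..1}) = p * D"
      using t by (intro vector_derivative_within_closed_interval) auto
    then have "2 / (1 - (norm (\<gamma> t))\<^sup>2) * norm (vector_derivative \<gamma> (at t within {0..1}))
      = 2 * q * (norm D / (1 - (norm (Moebius_function 0 (- a) w))\<^sup>2))"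
      by (simp add: \<gamma>_def w_def q_def norm_mult)
    also have "\<dots> = 2 * q / (1 - (t * q)\<^sup>2)"
      unfolding D_def Moebius_infinitesimal_isometry[OF a w1] by (simp add: nw)
    finally show ?thesis .
  qed
  then show "has_poincare_length \<gamma> (2 * artanh (norm p))"
    unfolding has_poincare_length_def q_def[symmetric] using * by (subst has_integral_cong) auto
qed

lemma poincare_dist_eq:
  assumes "norm a < 1" "norm b < 1"
  shows "poincare_dist a b = 2 * artanh (norm (Moebius_function 0 a b))"
proof -
  define p where "p = Moebius_function 0 a b"
  have "norm p < 1" unfolding p_def using assms by (rule Moebius_function_norm_lt_1)
  note seg = Moebius_segment_length[OF assms(1) this]
  show ?thesis
    unfolding poincare_dist_def
  proof (rule cInf_eq_minimum)
    \<comment> \<open>For \<open>p = M\<^sub>a(b)\<close> the image of the segment runs from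
      \<open>M\<^sub>-\<^sub>a(0) = a\<close> to \<open>M\<^sub>-\<^sub>a(M\<^sub>a(b)) = b\<close>,
      so the infimum is a minimum.\<close>
    show "2 * artanh (norm (Moebius_function 0 a b)) \<in> {L. \<exists>\<gamma>. valid_path \<gamma> \<and> path_image \<gamma> \<subseteq> unit_disk \<and>
                pathstart \<gamma> = a \<and> pathfinish \<gamma> = b \<and> has_poincare_length \<gamma> L}"
      using seg assms Moebius_inverse
      by (intro CollectI exI[of _ "Moebius_function 0 (- a) \<circ> linepath 0 p"])
        (auto simp: pathstart_compose pathfinish_compose p_def Moebius_function_of_zero)
  qed (auto intro: poincare_length_ge)
qed

section \<open>The Caratheodory distance of the punctured disk\<close>

lemma Schwarz_Pick_punctured_disk:
  assumes hol: "f holomorphic_on punctured_unit_disk"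
    and im: "f ` punctured_unit_disk \<subseteq> unit_disk"
    and z: "z \<in> punctured_unit_disk" and w: "w \<in> punctured_unit_disk"
  shows "norm (Moebius_function 0 (f z) (f w)) \<le> norm (Moebius_function 0 z w)"
proof -
  have pd: "punctured_unit_disk = unit_disk - {0}"
    by (auto simp: punctured_unit_disk_def)
  have z1: "norm z < 1" and w1: "norm w < 1" and fz: "norm (f z) < 1"
    using z w im by (auto simp: pd image_subset_iff)
  \<comment> \<open>Postcomposing with a Moebius map moves \<open>f z\<close> to 0; the result is
    bounded and extends over the puncture to \<open>G\<close>.\<close>
  define h where "h = Moebius_function 0 (f z) \<circ> f"
  have h_lt: "norm (h x) < 1" if "x \<in> punctured_unit_disk" for x
    unfolding h_def o_def using im that fz by (intro Moebius_function_norm_lt_1) auto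
  have "h holomorphic_on unit_disk - {0}"
    unfolding h_def pd[symmetric]
    by (rule holomorphic_on_compose_gen[OF hol Moebius_function_holomorphic[OF fz] im])
  moreover have "\<exists>B. eventually (\<lambda>x. norm (h x) \<le> B) (at 0)"
  proof
    show "eventually (\<lambda>x. norm (h x) \<le> 1) (at 0)"
      using h_lt by (auto simp: eventually_at pd intro!: exI[of _ 1] less_imp_le)
  qed
  ultimately obtain G where G: "G holomorphic_on unit_disk" "\<And>x. x \<in> unit_disk - {0} \<Longrightarrow> G x = h x"
    using holomorphic_on_extend_bounded[of h unit_disk 0] by auto
  have G_z: "G z = 0"
    using G(2)[of z] z by (simp add: pd h_def Moebius_function_eq_zero)
  \<comment> \<open>Boundedness alone puts \<open>G 0\<close> only in the closed disk. A value of
    norm at least 1 would be an interior maximum of the modulus, making \<open>G\<close> constant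
    although \<open>G z = 0\<close>.\<close>
  have G0: "norm (G 0) < 1"
  proof (rule ccontr)
    assume "\<not> norm (G 0) < 1"
    then have "norm (G x) \<le> norm (G 0)" if "x \<in> unit_disk" for x
      using that G(2)[of x] h_lt[of x] by (cases "x = 0") (auto simp: pd)
    then have "G constant_on unit_disk"
      using G(1) by (intro maximum_modulus_principle[of G unit_disk unit_disk 0]) auto
    then have "G 0 = G z"
      using z1 by (auto simp: constant_on_def)
    then show False using G_z \<open>\<not> norm (G 0) < 1\<close> by simp
  qed
  have G1: "norm (G x) < 1" if "norm x < 1" for x
    using G0 G(2)[of x] h_lt[of x] that by (cases "x = 0") (auto simp: pd)
  have z1': "norm (- z) < 1" using z1 by simp
  \<comment> \<open>Since \<open>M\<^sub>-\<^sub>z\<close> sends 0 to the zero \<open>z\<close> of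
    \<open>G\<close>, the composite fixes 0; at \<open>M\<^sub>z(w)\<close> its value is
    \<open>G w = h w\<close>.\<close>
  have "norm ((G \<circ> Moebius_function 0 (- z)) (Moebius_function 0 z w)) \<le> norm (Moebius_function 0 z w)"
  proof (rule Schwarz_Lemma)
    show "G \<circ> Moebius_function 0 (- z) holomorphic_on unit_disk"
      using Moebius_function_norm_lt_1[OF z1']
      by (intro holomorphic_on_compose_gen[OF Moebius_function_holomorphic[OF z1'] G(1)]) auto
    show "norm ((G \<circ> Moebius_function 0 (- z)) x) < 1" if "norm x < 1" for x
      using G1[OF Moebius_function_norm_lt_1[OF z1' that]] by simp
  qed (auto simp: Moebius_function_of_zero G_z Moebius_function_norm_lt_1[OF z1 w1])
  then show ?thesis
    using G(2)[of w] w by (simp add: Moebius_inverse[OF z1 w1] pd h_def)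
qed

text \<open>Schwarz-Pick bounds every competitor, and the inclusion into the disk,
  \<open>id\<close>, attains the bound.\<close>

lemma caratheodory_dist_punctured_disk:
  assumes z: "z \<in> punctured_unit_disk" and w: "w \<in> punctured_unit_disk"
  shows "caratheodory_dist punctured_unit_disk z w = ereal (2 * artanh (norm (Moebius_function 0 z w)))"
proof -
  have z1: "norm z < 1" and w1: "norm w < 1"
    using z w by (auto simp: punctured_unit_disk_def)
  show ?thesis
    unfolding caratheodory_dist_def
  proof (rule Sup_eqI)
    fix y
    assume "y \<in> {ereal (poincare_dist (f z) (f w)) |f.
       f holomorphic_on punctured_unit_disk \<and> f ` punctured_unit_disk \<subseteq> unit_disk}"
    then obtain f where f: "f holomorphic_on punctured_unit_disk" "f ` punctured_unit_disk \<subseteq> unit_disk"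
      and y: "y = ereal (poincare_dist (f z) (f w))" by auto
    have fz: "norm (f z) < 1" "norm (f w) < 1" using f(2) z w by auto
    have "\<not> artanh (norm (Moebius_function 0 z w)) < artanh (norm (Moebius_function 0 (f z) (f w)))"
      using Schwarz_Pick_punctured_disk[OF f z w]
        Moebius_function_norm_lt_1[OF z1 w1, of 0] Moebius_function_norm_lt_1[OF fz, of 0]
      by (subst artanh_real_less_iff) auto
    then show "y \<le> ereal (2 * artanh (norm (Moebius_function 0 z w)))"
      by (simp add: y poincare_dist_eq[OF fz])
  next
    fix y
    assume "\<And>x. x \<in> {ereal (poincare_dist (f z) (f w)) |f.
       f holomorphic_on punctured_unit_disk \<and> f ` punctured_unit_disk \<subseteq> unit_disk} \<Longrightarrow> x \<le> y"
    from this[OF CollectI, OF exI[of _ id]]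
    show "ereal (2 * artanh (norm (Moebius_function 0 z w))) \<le> y"
      by (simp add: poincare_dist_eq[OF z1 w1] punctured_unit_disk_def subset_iff)
  qed
qed

section \<open>Caratheodory balls and the Fridman function of the punctured disk\<close>

lemma caratheodory_ball_punctured_disk:
  assumes z: "z \<in> punctured_unit_disk"
  shows "caratheodory_ball punctured_unit_disk z r =
    {w \<in> punctured_unit_disk. norm (Moebius_function 0 z w) < tanh (r / 2)}"
proof -
  have "caratheodory_dist punctured_unit_disk z w < ereal r \<longleftrightarrow> norm (Moebius_function 0 z w) < tanh (r / 2)"
    if w: "w \<in> punctured_unit_disk" for w
  proof -
    have "norm (Moebius_function 0 z w) < 1"
      using z w by (intro Moebius_function_norm_lt_1) (auto simp: punctured_unit_disk_def)
    \<comment> \<open>Rewriting \<open>r / 2\<close> as \<open>artanh (tanh (r / 2))\<close> makes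
      the comparison one of artanh values; it covers \<open>r \<le> 0\<close> too, as tanh stays in
      (-1, 1).\<close>
    then have "artanh (norm (Moebius_function 0 z w)) < artanh (tanh (r / 2)) \<longleftrightarrow>
        norm (Moebius_function 0 z w) < tanh (r / 2)"
      by (intro artanh_real_less_iff) (auto simp: abs_less_iff tanh_real_lt_1 tanh_real_gt_neg1
          minus_less_iff)
    then show ?thesis
      by (simp add: caratheodory_dist_punctured_disk[OF z w] artanh_tanh_real field_simps)
  qed
  then show ?thesis
    by (auto simp: caratheodory_ball_def)
qed

text \<open>The image is homeomorphic to a disk, hence simply connected, so closed paths in it have
  winding number 0 about the omitted point \<open>c\<close>; the circle has winding number
  1.\<close>

lemma injective_image_no_circle_about_omitted_point:
  assumes hol: "f holomorphic_on unit_disk" and inj: "inj_on f unit_disk"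
    and "c \<notin> f ` unit_disk" "0 < e"
  shows "\<not> sphere c e \<subseteq> f ` unit_disk"
proof
  assume sub: "sphere c e \<subseteq> f ` unit_disk"
  obtain g where g: "g holomorphic_on f ` unit_disk" "\<And>z. z \<in> unit_disk \<Longrightarrow> g (f z) = z"
    using holomorphic_has_inverse[OF hol open_ball inj] by metis
  have "homeomorphism unit_disk (f ` unit_disk) f g"
    using hol g by (intro homeomorphismI holomorphic_on_imp_continuous_on) auto
  then have "simply_connected (f ` unit_disk)"
    using homeomorphic_simply_connected_eq homeomorphic_def convex_imp_simply_connected[OF convex_ball]
    by blast
  then have "winding_number (circlepath c e) c = 0"
    using sub assms by (intro simply_connected_imp_winding_number_zero[of "f ` unit_disk"]) auto
  then show False
    using winding_number_circlepath_centre[OF \<open>0 < e\<close>, of c] by simp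
qed

theorem theorem3p12:
  fixes z :: complex
  assumes "z \<in> punctured_unit_disk"
  shows "fridman_caratheodory punctured_unit_disk z = norm z"
  unfolding fridman_caratheodory_def caratheodory_ball_punctured_disk[OF assms]
proof (rule cSup_eq_maximum)
  have z: "0 < norm z" "norm z < 1" "norm (- z) < 1"
    using assms by (auto simp: punctured_unit_disk_def)
  define s where "s = norm z"
  \<comment> \<open>Dilation by \<open>norm z\<close> followed by \<open>M\<^sub>-\<^sub>z\<close>
    maps the disk onto the pseudohyperbolic disk of radius \<open>norm z\<close> about
    \<open>z\<close>, whose boundary passes through the origin.\<close>
  define f where "f = (\<lambda>x. Moebius_function 0 (- z) (of_real s * x))"
  have s: "0 < s" "s < 1" using z by (auto simp: s_def)
  have sx: "norm (of_real s * x) < s" if "norm x < 1" for x :: complex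
    using that s by (simp add: norm_mult)
  have sx1: "norm (of_real s * x) < 1" if "norm x < 1" for x :: complex
    using sx[OF that] s by simp
  have M_f: "Moebius_function 0 z (f x) = of_real s * x" if "norm x < 1" for x
    unfolding f_def by (rule Moebius_inverse(2)[OF z(2) sx1[OF that]])
  have f_norm: "norm (f x) < 1" if "norm x < 1" for x
    unfolding f_def by (rule Moebius_function_norm_lt_1[OF z(3) sx1[OF that]])
  \<comment> \<open>At a zero of \<open>f\<close> the value \<open>M\<^sub>z(0) = -z\<close> of norm
    \<open>s\<close> would equal \<open>s * x\<close>, which has smaller norm.\<close>
  have f_nz: "f x \<noteq> 0" if "norm x < 1" for x
  proof
    assume "f x = 0"
    then have "norm (of_real s * x) = s"
      unfolding M_f[OF that, symmetric] by (simp add: Moebius_function_of_zero s_def)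
    then show False using sx[OF that] by simp
  qed
  have "Moebius_function 0 (- z) \<circ> (\<lambda>x. of_real s * x) holomorphic_on unit_disk"
    using sx1 by (intro holomorphic_on_compose_gen[OF _ Moebius_function_holomorphic[OF z(3)]])
      (auto intro!: holomorphic_intros)
  then have "f holomorphic_on unit_disk"
    by (simp add: f_def o_def)
  moreover have "inj_on f unit_disk"
  proof (rule inj_onI)
    fix x y assume "x \<in> unit_disk" "y \<in> unit_disk" "f x = f y"
    then have "of_real s * x = of_real s * y" by (metis M_f mem_ball_0)
    then show "x = y" using s by simp
  qed
  moreover have "f ` unit_disk \<subseteq> punctured_unit_disk"
    using f_norm f_nz by (auto simp: punctured_unit_disk_def)
  moreover have "{w \<in> punctured_unit_disk. norm (Moebius_function 0 z w) < s} \<subseteq> f ` unit_disk"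
  proof clarify
    fix w assume w: "w \<in> punctured_unit_disk" "norm (Moebius_function 0 z w) < s"
    then have "w = f (Moebius_function 0 z w / of_real s)"
      using s Moebius_inverse(1)[OF z(2), of w] by (simp add: f_def punctured_unit_disk_def)
    moreover have "Moebius_function 0 z w / of_real s \<in> unit_disk"
      using w s by (simp add: norm_divide)
    ultimately show "w \<in> f ` unit_disk" by blast
  qed
  \<comment> \<open>The radius \<open>2 * artanh s\<close> is chosen so that its value
    \<open>tanh (r / 2)\<close> is exactly \<open>norm z\<close>.\<close>
  moreover have r: "tanh (2 * artanh s / 2) = s" "0 < 2 * artanh s"
    using s artanh_real_less_iff[of 0 s] by (simp_all add: tanh_artanh_real)
  ultimately have "\<exists>f. f holomorphic_on unit_disk \<and> inj_on f unit_disk \<and> f ` unit_disk \<subseteq> punctured_unit_disk \<and>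
      {w \<in> punctured_unit_disk. norm (Moebius_function 0 z w) < tanh (2 * artanh s / 2)} \<subseteq> f ` unit_disk"
    unfolding r by blast
  with r show "norm z \<in> {tanh (r / 2) |r. r > 0 \<and>
      (\<exists>f. f holomorphic_on unit_disk \<and> inj_on f unit_disk \<and> f ` unit_disk \<subseteq> punctured_unit_disk \<and>
        {w \<in> punctured_unit_disk. norm (Moebius_function 0 z w) < tanh (r / 2)} \<subseteq> f ` unit_disk)}"
    unfolding s_def[symmetric] by (intro CollectI exI[of _ "2 * artanh s"] conjI) simp_all
next
  have z: "norm z < 1"
    using assms by (auto simp: punctured_unit_disk_def)
  fix y
  assume "y \<in> {tanh (r / 2) |r. r > 0 \<and>
      (\<exists>f. f holomorphic_on unit_disk \<and> inj_on f unit_disk \<and> f ` unit_disk \<subseteq> punctured_unit_disk \<and>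
        {w \<in> punctured_unit_disk. norm (Moebius_function 0 z w) < tanh (r / 2)} \<subseteq> f ` unit_disk)}"
  then obtain f where f: "f holomorphic_on unit_disk" "inj_on f unit_disk"
      "f ` unit_disk \<subseteq> punctured_unit_disk"
    and sub: "{w \<in> punctured_unit_disk. norm (Moebius_function 0 z w) < y} \<subseteq> f ` unit_disk"
    by blast
  show "y \<le> norm z"
  proof (rule ccontr)
    assume "\<not> y \<le> norm z"
    \<comment> \<open>Unlike the Caratheodory ball, \<open>S\<close> keeps the origin, because
      \<open>norm (M\<^sub>z(0)) = norm z < y\<close>. Being open, it contains a small closed disk
      about 0, whose boundary circle lies in the ball.\<close>
    define S where "S = {w \<in> unit_disk. norm (Moebius_function 0 z w) < y}"
    have "open S"
    proof -
      have "continuous_on unit_disk (\<lambda>w. norm (Moebius_function 0 z w))"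
        by (intro continuous_on_norm holomorphic_on_imp_continuous_on Moebius_function_holomorphic z)
      from continuous_open_preimage[OF this open_ball open_lessThan[of y]]
      show ?thesis by (simp add: S_def vimage_def Int_def)
    qed
    moreover have "0 \<in> S"
      using \<open>\<not> y \<le> norm z\<close> by (simp add: S_def Moebius_function_of_zero)
    ultimately obtain e where e: "0 < e" "cball 0 e \<subseteq> S"
      by (meson open_contains_cball)
    then have "sphere 0 e \<subseteq> {w \<in> punctured_unit_disk. norm (Moebius_function 0 z w) < y}"
      by (auto simp: S_def punctured_unit_disk_def subset_iff)
    then have "sphere 0 e \<subseteq> f ` unit_disk"
      using sub by blast
    moreover have "0 \<notin> f ` unit_disk"
      using f(3) by (auto simp: punctured_unit_disk_def)
    ultimately show False
      using injective_image_no_circle_about_omitted_point[OF f(1,2)] e(1) by blast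
  qed
qed

end
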